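(* A discrete action of a group $G$ on a uniform space $X$ induces a uniform covering map $X\to X/G$; that is, if the action of $G$ on $X$ is discrete, then the projection $p\colon X\to X/G$ is a uniform covering map.
   Context: All entourages are symmetric subsets containing the diagonal. The action is a left action by bijections. $X/G$ is the orbit set and $p$ the quotient map. The action is equicontinuous if for every entourage $E$ of $X$ there is an entourage $F$ of $X$ such that $(g\cdot x,g\cdot y)\in E$ for all $g\in G$ and $(x,y)\in F$. It is uniformly properly discontinuous if there is an entourage $E$ of $X$ such that for all $x\in X$ and $g\in G$, $(x,g\cdot x)\in E$ implies $g=1$. It is discrete if it is equicontinuous and uniformly properly discontinuous. For $f\colon X\to Y$ and $E\subset X\times X$, $f(E)=\{(f(x),f(y)) : (x,y)\in E\}$. An $E$-chain is a finite sequence $x_1,\dots,x_n$ with $(x_i,x_{i+1})\in E$ for all $i<n$. A map $f\colon X\to Y$ generates the uniform structure on $Y$ if the sets $f(E)$, $E$ an entourage of $X$, are entourages of $Y$ and form a base of its uniform structure. A surjective $f$ has the chain lifting property if for any entourage $E$ of $X$ there is an entourage $F$ of $X$ such that for every $x_0\in X$ any $f(F)$-chain in $Y$ starting from $f(x_0)$ lifts to an $E$-chain starting from $x_0$. It has the uniqueness of chain lifts property if for every entourage $E$ of $X$ there is an entourage $F$ of $X$ such that any two $F$-chains $\alpha,\beta$ with $f(\alpha)=f(\beta)$ and the same initial point are equal. A uniform covering map is a map that generates the uniform structure on its target and has both properties. $X/G$ carries the uniform structure generated by $p$ (base: the sets $p(E)$). *)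

theory Defs
  imports Complex_Main "HOL-Algebra.Group_Action"
begin

(* The orbit space is a set of sets that depends on the action, not a type, so it cannot be an
   instance of the class uniform_space. Uniform spaces are therefore given by a carrier set X and
   the set U of their entourages, all entourages being symmetric: upward closure is required only
   among symmetric relations. No separation axiom is imposed. *)

definition uniform_structure :: "'a set \<Rightarrow> ('a \<times> 'a) set set \<Rightarrow> bool" where
  "uniform_structure X U \<longleftrightarrow>
     U \<noteq> {} \<and>
     (\<forall>E\<in>U. E \<subseteq> X \<times> X \<and> Id_on X \<subseteq> E \<and> sym E) \<and>
     (\<forall>E\<in>U. \<forall>F. E \<subseteq> F \<and> F \<subseteq> X \<times> X \<and> sym F \<longrightarrow> F \<in> U) \<and>
     (\<forall>E\<in>U. \<forall>F\<in>U. E \<inter> F \<in> U) \<and>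
     (\<forall>E\<in>U. \<exists>F\<in>U. F O F \<subseteq> E)"

(* Agreement with the type class: the symmetric members of the filter uniformity. *)
lemma uniform_structure_uniformity:
  "uniform_structure (UNIV :: 'a::uniform_space set)
     {E. sym E \<and> (\<forall>\<^sub>F p in uniformity. p \<in> E)}"
  unfolding uniform_structure_def
proof (intro conjI ballI allI impI)
  show "{E :: ('a \<times> 'a) set. sym E \<and> (\<forall>\<^sub>F p in uniformity. p \<in> E)} \<noteq> {}"
    by (auto intro!: exI[of _ UNIV] simp: sym_def)
next
  fix E :: "('a \<times> 'a) set"
  assume E: "E \<in> {E. sym E \<and> (\<forall>\<^sub>F p in uniformity. p \<in> E)}"
  show "E \<subseteq> UNIV \<times> UNIV" by simp
  show "Id_on UNIV \<subseteq> E" using E uniformity_refl[of "\<lambda>p. p \<in> E"] by auto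
  show "sym E" using E by simp
  fix F :: "('a \<times> 'a) set"
  show "F \<in> {E. sym E \<and> (\<forall>\<^sub>F p in uniformity. p \<in> E)}"
    if "E \<subseteq> F \<and> F \<subseteq> UNIV \<times> UNIV \<and> sym F"
    using E that by (auto elim: eventually_mono)
  show "E \<inter> F \<in> {E. sym E \<and> (\<forall>\<^sub>F p in uniformity. p \<in> E)}"
    if "F \<in> {E. sym E \<and> (\<forall>\<^sub>F p in uniformity. p \<in> E)}"
    using E that by (auto simp: sym_Int eventually_conj)
next
  fix E :: "('a \<times> 'a) set"
  assume E: "E \<in> {E. sym E \<and> (\<forall>\<^sub>F p in uniformity. p \<in> E)}"
  then obtain D where D: "eventually D uniformity"
    and DD: "\<And>x y z. D (x, y) \<Longrightarrow> D (y, z) \<Longrightarrow> (x, z) \<in> E"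
    using uniformity_transE[of "\<lambda>p. p \<in> E"] by blast
  define F where "F = {(x, y). D (x, y) \<and> D (y, x)}"
  have "\<forall>\<^sub>F p in uniformity. p \<in> F"
    using eventually_conj[OF D uniformity_sym[OF D]] by (auto simp: F_def case_prod_beta)
  moreover have "sym F" by (auto simp: F_def sym_def)
  moreover have "F O F \<subseteq> E" using DD by (auto simp: F_def)
  ultimately show "\<exists>F\<in>{E. sym E \<and> (\<forall>\<^sub>F p in uniformity. p \<in> E)}. F O F \<subseteq> E" by blast
qed

definition equicontinuous_action ::
    "('g, 'm) monoid_scheme \<Rightarrow> ('a \<times> 'a) set set \<Rightarrow> ('g \<Rightarrow> 'a \<Rightarrow> 'a) \<Rightarrow> bool" where
  "equicontinuous_action G U \<phi> \<longleftrightarrow>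
     (\<forall>E\<in>U. \<exists>F\<in>U. \<forall>g\<in>carrier G. \<forall>(x, y)\<in>F. (\<phi> g x, \<phi> g y) \<in> E)"

definition uniformly_properly_discontinuous ::
    "('g, 'm) monoid_scheme \<Rightarrow> 'a set \<Rightarrow> ('a \<times> 'a) set set \<Rightarrow> ('g \<Rightarrow> 'a \<Rightarrow> 'a) \<Rightarrow> bool" where
  "uniformly_properly_discontinuous G X U \<phi> \<longleftrightarrow>
     (\<exists>E\<in>U. \<forall>x\<in>X. \<forall>g\<in>carrier G. (x, \<phi> g x) \<in> E \<longrightarrow> g = \<one>\<^bsub>G\<^esub>)"

definition discrete_action ::
    "('g, 'm) monoid_scheme \<Rightarrow> 'a set \<Rightarrow> ('a \<times> 'a) set set \<Rightarrow> ('g \<Rightarrow> 'a \<Rightarrow> 'a) \<Rightarrow> bool" where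
  "discrete_action G X U \<phi> \<longleftrightarrow>
     equicontinuous_action G U \<phi> \<and> uniformly_properly_discontinuous G X U \<phi>"

definition rel_image :: "('a \<Rightarrow> 'b) \<Rightarrow> ('a \<times> 'a) set \<Rightarrow> ('b \<times> 'b) set" where
  "rel_image f E = {(f x, f y) | x y. (x, y) \<in> E}"

(* Chains are nonempty. The carrier is needed because a one-point chain involves no pair in E. *)
definition chain_in :: "'a set \<Rightarrow> ('a \<times> 'a) set \<Rightarrow> 'a list \<Rightarrow> bool" where
  "chain_in X E xs \<longleftrightarrow>
     xs \<noteq> [] \<and> set xs \<subseteq> X \<and> (\<forall>i. Suc i < length xs \<longrightarrow> (xs ! i, xs ! Suc i) \<in> E)"

definition generates_uniform_structure ::
    "('a \<times> 'a) set set \<Rightarrow> ('b \<times> 'b) set set \<Rightarrow> ('a \<Rightarrow> 'b) \<Rightarrow> bool" where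
  "generates_uniform_structure U V f \<longleftrightarrow>
     (\<forall>E\<in>U. rel_image f E \<in> V) \<and> (\<forall>D\<in>V. \<exists>E\<in>U. rel_image f E \<subseteq> D)"

definition chain_lifting ::
    "'a set \<Rightarrow> ('a \<times> 'a) set set \<Rightarrow> 'b set \<Rightarrow> ('a \<Rightarrow> 'b) \<Rightarrow> bool" where
  "chain_lifting X U Y f \<longleftrightarrow>
     f ` X = Y \<and>
     (\<forall>E\<in>U. \<exists>F\<in>U. \<forall>x0\<in>X. \<forall>c. chain_in Y (rel_image f F) c \<and> hd c = f x0 \<longrightarrow>
        (\<exists>\<alpha>. chain_in X E \<alpha> \<and> hd \<alpha> = x0 \<and> map f \<alpha> = c))"

definition unique_chain_lifts ::
    "'a set \<Rightarrow> ('a \<times> 'a) set set \<Rightarrow> ('a \<Rightarrow> 'b) \<Rightarrow> bool" where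
  "unique_chain_lifts X U f \<longleftrightarrow>
     (\<forall>E\<in>U. \<exists>F\<in>U. \<forall>\<alpha> \<beta>. chain_in X F \<alpha> \<and> chain_in X F \<beta> \<and>
        map f \<alpha> = map f \<beta> \<and> hd \<alpha> = hd \<beta> \<longrightarrow> \<alpha> = \<beta>)"

definition uniform_covering_map ::
    "'a set \<Rightarrow> ('a \<times> 'a) set set \<Rightarrow> 'b set \<Rightarrow> ('b \<times> 'b) set set \<Rightarrow> ('a \<Rightarrow> 'b) \<Rightarrow> bool" where
  "uniform_covering_map X U Y V f \<longleftrightarrow>
     generates_uniform_structure U V f \<and> chain_lifting X U Y f \<and> unique_chain_lifts X U f"

(* The family of symmetric relations on Y with base the sets f(E). Without further assumptions on f
   it need not satisfy the axioms of a uniform structure. *)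
definition generated_entourages ::
    "('a \<times> 'a) set set \<Rightarrow> 'b set \<Rightarrow> ('a \<Rightarrow> 'b) \<Rightarrow> ('b \<times> 'b) set set" where
  "generated_entourages U Y f =
     {D. D \<subseteq> Y \<times> Y \<and> sym D \<and> (\<exists>E\<in>U. rel_image f E \<subseteq> D)}"

end

theory Submission imports Defs begin

text \<open>
  Everything rests on one kind of entourage. By equicontinuity the entourages \<open>F\<close> that are invariant
  under \<open>G\<close> form a base (\<open>invariant_entourage\<close>), and an invariant \<open>F\<close> lifts steps through the
  projection \<open>p\<close>: if \<open>(p x, q)\<close> comes from a pair \<open>(a, b)\<close> of \<open>F\<close> with \<open>p a = p x\<close>, then the element
  of \<open>G\<close> that carries \<open>a\<close> to \<open>x\<close> carries \<open>b\<close> to a point above \<open>q\<close> that is \<open>F\<close>-close to \<open>x\<close>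
  (\<open>invariant_lifts_steps\<close>).

  A base of step-lifting entourages has two consequences for any surjection. The relations \<open>p(E)\<close>
  satisfy the triangle axiom, since two consecutive steps of \<open>p(F)\<close> lift to two consecutive steps of
  \<open>F\<close>, so they generate a uniform structure. And chains lift, one step after the other.

  Uniqueness uses proper discontinuity in the form that sufficiently close points of one orbit
  coincide. If \<open>y\<close> and \<open>g y\<close> are both \<open>F\<close>-close to \<open>x\<close> and \<open>F O F\<close> lies in the entourage of proper
  discontinuity, then \<open>g\<close> is the identity. So two \<open>F\<close>-chains over the same chain that agree at one
  point agree at the next one.
\<close>

section \<open>Maps that lift steps\<close>

definition lifts_steps :: "'a set \<Rightarrow> ('a \<Rightarrow> 'b) \<Rightarrow> ('a \<times> 'a) set \<Rightarrow> bool" where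
  "lifts_steps X f F \<longleftrightarrow>
     (\<forall>x\<in>X. \<forall>q. (f x, q) \<in> rel_image f F \<longrightarrow> (\<exists>y. (x, y) \<in> F \<and> f y = q))"

lemma uniform_structureD:
  assumes "uniform_structure X U"
  shows "U \<noteq> {}"
    and "E \<in> U \<Longrightarrow> E \<subseteq> X \<times> X"
    and "E \<in> U \<Longrightarrow> Id_on X \<subseteq> E"
    and "E \<in> U \<Longrightarrow> sym E"
    and "E \<in> U \<Longrightarrow> E \<subseteq> F \<Longrightarrow> F \<subseteq> X \<times> X \<Longrightarrow> sym F \<Longrightarrow> F \<in> U"
    and "E \<in> U \<Longrightarrow> F \<in> U \<Longrightarrow> E \<inter> F \<in> U"
    and "E \<in> U \<Longrightarrow> \<exists>F\<in>U. F O F \<subseteq> E"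
proof -
  note axioms = assms[unfolded uniform_structure_def]
  show "U \<noteq> {}"
    using axioms by (rule conjunct1)
  note entourage = axioms[THEN conjunct2, THEN conjunct1]
  show "E \<in> U \<Longrightarrow> E \<subseteq> X \<times> X" "E \<in> U \<Longrightarrow> Id_on X \<subseteq> E" "E \<in> U \<Longrightarrow> sym E"
    using entourage by (fast dest: bspec)+
  show "E \<in> U \<Longrightarrow> E \<subseteq> F \<Longrightarrow> F \<subseteq> X \<times> X \<Longrightarrow> sym F \<Longrightarrow> F \<in> U"
    using axioms[THEN conjunct2, THEN conjunct2, THEN conjunct1, rule_format, of E F] by simp
  show "E \<in> U \<Longrightarrow> F \<in> U \<Longrightarrow> E \<inter> F \<in> U"
    using axioms[THEN conjunct2, THEN conjunct2, THEN conjunct2, THEN conjunct1] by simp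
  show "E \<in> U \<Longrightarrow> \<exists>F\<in>U. F O F \<subseteq> E"
    using axioms[THEN conjunct2, THEN conjunct2, THEN conjunct2, THEN conjunct2] by simp
qed

lemma rel_image_mono: "E \<subseteq> F \<Longrightarrow> rel_image f E \<subseteq> rel_image f F"
  by (auto simp: rel_image_def)

lemma rel_image_entourage:
  assumes "uniform_structure X U" and "E \<in> U"
  shows "rel_image f E \<subseteq> f ` X \<times> f ` X" "Id_on (f ` X) \<subseteq> rel_image f E" "sym (rel_image f E)"
proof -
  have E: "E \<subseteq> X \<times> X" "Id_on X \<subseteq> E" "sym E"
    using uniform_structureD(2-4)[OF assms] .
  show "rel_image f E \<subseteq> f ` X \<times> f ` X" using E(1) by (auto simp: rel_image_def)
  show "Id_on (f ` X) \<subseteq> rel_image f E" using E(2) by (auto simp: rel_image_def)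
  show "sym (rel_image f E)" using E(3) by (auto simp: rel_image_def sym_def)
qed

lemma generates_generated_entourages:
  assumes "uniform_structure X U"
  shows "generates_uniform_structure U (generated_entourages U (f ` X) f) f"
  using rel_image_entourage[OF assms, of _ f]
  unfolding generates_uniform_structure_def generated_entourages_def by blast

text \<open>Only the triangle axiom can fail for the images of entourages; lifting the second of two
  consecutive steps to the end point of the first one restores it.\<close>
lemma rel_image_relcomp:
  assumes "lifts_steps X f F" and "F \<subseteq> X \<times> X"
  shows "rel_image f F O rel_image f F \<subseteq> rel_image f (F O F)"
proof (rule subrelI)
  fix p r
  assume "(p, r) \<in> rel_image f F O rel_image f F"
  then obtain q where "(p, q) \<in> rel_image f F" and r: "(q, r) \<in> rel_image f F"
    by auto
  then obtain x y where xy: "(x, y) \<in> F" "p = f x" "q = f y"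
    by (auto simp: rel_image_def)
  with r assms obtain z where "(y, z) \<in> F" "f z = r"
    unfolding lifts_steps_def by blast
  with xy show "(p, r) \<in> rel_image f (F O F)"
    by (auto simp: rel_image_def)
qed

lemma uniform_structure_generated_entourages:
  assumes U: "uniform_structure X U"
    and base: "\<And>E. E \<in> U \<Longrightarrow> \<exists>F\<in>U. F \<subseteq> E \<and> lifts_steps X f F"
  shows "uniform_structure (f ` X) (generated_entourages U (f ` X) f)"
    (is "uniform_structure ?Y ?V")
proof -
  note image = rel_image_entourage[OF U, of _ f]
  have V_I: "D \<in> ?V" if "D \<subseteq> ?Y \<times> ?Y" "sym D" "E \<in> U" "rel_image f E \<subseteq> D" for D E
    using that by (auto simp: generated_entourages_def)
  have V_D: "D \<subseteq> ?Y \<times> ?Y \<and> sym D \<and> (\<exists>E\<in>U. rel_image f E \<subseteq> D)" if "D \<in> ?V" for D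
    using that by (auto simp: generated_entourages_def)
  have image_V: "rel_image f E \<in> ?V" if "E \<in> U" for E
    using V_I[OF image(1,3) that order_refl] that by blast
  show ?thesis
    unfolding uniform_structure_def
  proof (intro conjI ballI allI impI)
    obtain E where "E \<in> U" using uniform_structureD(1)[OF U] by blast
    then show "?V \<noteq> {}" using image_V by blast
  next
    fix D assume D: "D \<in> ?V"
    show "D \<subseteq> ?Y \<times> ?Y" "sym D" using V_D[OF D] by blast+
    show "Id_on ?Y \<subseteq> D" using V_D[OF D] image(2) by (meson order_trans)
    show "D' \<in> ?V" if "D \<subseteq> D' \<and> D' \<subseteq> ?Y \<times> ?Y \<and> sym D'" for D'
      using V_D[OF D] that by (auto intro!: V_I)
    show "D \<inter> D' \<in> ?V" if D': "D' \<in> ?V" for D'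
    proof -
      obtain E E' where E: "E \<in> U" "E' \<in> U" "rel_image f E \<subseteq> D" "rel_image f E' \<subseteq> D'"
        using V_D[OF D] V_D[OF D'] by blast
      have "E \<inter> E' \<in> U" using uniform_structureD(6)[OF U E(1,2)] .
      moreover have "rel_image f (E \<inter> E') \<subseteq> D \<inter> D'"
        using E rel_image_mono[of "E \<inter> E'" E f] rel_image_mono[of "E \<inter> E'" E' f] by blast
      moreover have "D \<inter> D' \<subseteq> ?Y \<times> ?Y" "sym (D \<inter> D')"
        using V_D[OF D] V_D[OF D'] by (auto intro: sym_Int)
      ultimately show ?thesis by (intro V_I)
    qed
    obtain E where E: "E \<in> U" "rel_image f E \<subseteq> D" using V_D[OF D] by blast
    then obtain H where H: "H \<in> U" "H O H \<subseteq> E"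
      using uniform_structureD(7)[OF U] by blast
    then obtain F where F: "F \<in> U" "F \<subseteq> H" "lifts_steps X f F" using base by blast
    have "F \<subseteq> X \<times> X" using uniform_structureD(2)[OF U F(1)] .
    then have "rel_image f F O rel_image f F \<subseteq> rel_image f (F O F)"
      using F(3) by (rule rel_image_relcomp[rotated])
    also have "\<dots> \<subseteq> rel_image f E"
      using F(2) H(2) by (intro rel_image_mono) blast
    finally have "rel_image f F O rel_image f F \<subseteq> D" using E(2) by blast
    then show "\<exists>D'\<in>?V. D' O D' \<subseteq> D" using image_V[OF F(1)] by blast
  qed
qed

lemma chain_in_singleton: "chain_in X E [x] \<longleftrightarrow> x \<in> X"
  by (auto simp: chain_in_def)

lemma chain_in_Cons_Cons:
  "chain_in X E (x # y # zs) \<longleftrightarrow> x \<in> X \<and> (x, y) \<in> E \<and> chain_in X E (y # zs)"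
  by (auto simp: chain_in_def nth_Cons split: nat.splits)

lemma chain_in_mono: "E \<subseteq> F \<Longrightarrow> chain_in X E xs \<Longrightarrow> chain_in X F xs"
  by (auto simp: chain_in_def)

lemma lift_chain:
  assumes F: "lifts_steps X f F" "F \<subseteq> X \<times> X"
  shows "x \<in> X \<Longrightarrow> chain_in Y (rel_image f F) (f x # qs) \<Longrightarrow>
    \<exists>ys. chain_in X F (x # ys) \<and> map f ys = qs"
proof (induction qs arbitrary: x)
  case Nil
  then show ?case by (simp add: chain_in_singleton)
next
  case (Cons q qs)
  then have "(f x, q) \<in> rel_image f F" and qs: "chain_in Y (rel_image f F) (q # qs)"
    by (auto simp: chain_in_Cons_Cons)
  then obtain y where y: "(x, y) \<in> F" "f y = q"
    using F(1) Cons.prems(1) unfolding lifts_steps_def by blast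
  with F(2) have "y \<in> X" by blast
  then obtain ys where "chain_in X F (y # ys)" "map f ys = qs"
    using Cons.IH[of y] qs y(2) by blast
  with y Cons.prems(1) have "chain_in X F (x # y # ys) \<and> map f (y # ys) = q # qs"
    by (simp add: chain_in_Cons_Cons)
  then show ?case by (rule exI)
qed

lemma chain_liftingI:
  assumes U: "uniform_structure X U"
    and base: "\<And>E. E \<in> U \<Longrightarrow> \<exists>F\<in>U. F \<subseteq> E \<and> lifts_steps X f F"
  shows "chain_lifting X U (f ` X) f"
  unfolding chain_lifting_def
proof (intro conjI ballI)
  fix E assume "E \<in> U"
  then obtain F where F: "F \<in> U" "F \<subseteq> E" "lifts_steps X f F" using base by blast
  have FX: "F \<subseteq> X \<times> X" using uniform_structureD(2)[OF U F(1)] .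
  have "\<exists>\<alpha>. chain_in X E \<alpha> \<and> hd \<alpha> = x \<and> map f \<alpha> = c"
    if x: "x \<in> X" and c: "chain_in (f ` X) (rel_image f F) c" "hd c = f x" for x c
  proof -
    have "c = f x # tl c" using c by (cases c) (auto simp: chain_in_def)
    then obtain ys where "chain_in X F (x # ys)" "map f ys = tl c"
      using lift_chain[OF F(3) FX x] c(1) by metis
    then show ?thesis
      using \<open>c = f x # tl c\<close> chain_in_mono[OF F(2)] by (intro exI[of _ "x # ys"]) auto
  qed
  then show "\<exists>F\<in>U. \<forall>x0\<in>X. \<forall>c. chain_in (f ` X) (rel_image f F) c \<and> hd c = f x0 \<longrightarrow>
      (\<exists>\<alpha>. chain_in X E \<alpha> \<and> hd \<alpha> = x0 \<and> map f \<alpha> = c)"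
    using F(1) by blast
qed simp

lemma chain_lift_unique:
  assumes "\<And>x y y'. (x, y) \<in> F \<Longrightarrow> (x, y') \<in> F \<Longrightarrow> f y = f y' \<Longrightarrow> y = y'"
  shows "chain_in X F (x # ys) \<Longrightarrow> chain_in X F (x # zs) \<Longrightarrow> map f ys = map f zs \<Longrightarrow> ys = zs"
proof (induction ys arbitrary: x zs)
  case Nil
  then show ?case by simp
next
  case (Cons y ys)
  then obtain z zs' where zs: "zs = z # zs'" "f y = f z" "map f ys = map f zs'" by auto
  then have "y = z" using Cons.prems assms by (auto simp: chain_in_Cons_Cons)
  with Cons zs show ?case by (auto simp: chain_in_Cons_Cons)
qed

lemma unique_chain_liftsI:
  assumes "F \<in> U"
    and "\<And>x y y'. (x, y) \<in> F \<Longrightarrow> (x, y') \<in> F \<Longrightarrow> f y = f y' \<Longrightarrow> y = y'"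
  shows "unique_chain_lifts X U f"
  unfolding unique_chain_lifts_def
proof (intro ballI bexI[OF _ assms(1)] allI impI)
  fix \<alpha> \<beta>
  assume *: "chain_in X F \<alpha> \<and> chain_in X F \<beta> \<and> map f \<alpha> = map f \<beta> \<and> hd \<alpha> = hd \<beta>"
  then obtain x ys zs where "\<alpha> = x # ys" "\<beta> = x # zs"
    unfolding chain_in_def by (metis list.exhaust_sel)
  with * chain_lift_unique[OF assms(2)] show "\<alpha> = \<beta>" by auto
qed

section \<open>Discrete actions\<close>

lemma orbits_eq_image: "orbits G X \<phi> = orbit G \<phi> ` X"
  by (auto simp: orbits_def)

context group_action
begin

lemma orbit_eq_imp_translate:
  assumes "y \<in> E" and "orbit G \<phi> x = orbit G \<phi> y"
  shows "\<exists>g\<in>carrier G. y = \<phi> g x"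
  using orbit_refl[OF assms(1)] assms(2) by (auto simp: orbit_def)

lemma orbit_translate:
  assumes "x \<in> E" and "g \<in> carrier G"
  shows "orbit G \<phi> (\<phi> g x) = orbit G \<phi> x"
proof -
  have "\<phi> g x \<in> E" by (rule element_image[OF assms(2,1) refl])
  moreover have "\<phi> g x \<in> orbit G \<phi> x" using assms(2) by (auto simp: orbit_def)
  ultimately show ?thesis
    using assms(1) disjoint_union[of "orbit G \<phi> (\<phi> g x)" "orbit G \<phi> x"] orbit_refl[of "\<phi> g x"]
    by (auto simp: orbits_def)
qed

text \<open>The witness is the largest invariant relation inside the given entourage; equicontinuity says
  precisely that it contains an entourage.\<close>
lemma invariant_entourage:
  assumes U: "uniform_structure E U" and eq: "equicontinuous_action G U \<phi>" and D: "D \<in> U"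
  shows "\<exists>F\<in>U. F \<subseteq> D \<and> (\<forall>(x, y)\<in>F. \<forall>g\<in>carrier G. (\<phi> g x, \<phi> g y) \<in> F)"
proof -
  interpret group G
    using group_hom by (rule group_hom.axioms(1))
  define F where "F = {(x, y) \<in> E \<times> E. \<forall>g\<in>carrier G. (\<phi> g x, \<phi> g y) \<in> D}"
  obtain H where H: "H \<in> U" "\<forall>g\<in>carrier G. \<forall>(x, y)\<in>H. (\<phi> g x, \<phi> g y) \<in> D"
    using eq D unfolding equicontinuous_action_def by blast
  have "H \<subseteq> E \<times> E" "sym D"
    using uniform_structureD(2)[OF U H(1)] uniform_structureD(4)[OF U D] .
  then have "H \<subseteq> F" "sym F" "F \<subseteq> E \<times> E" using H(2) by (auto simp: F_def sym_def)
  then have "F \<in> U" using uniform_structureD(5)[OF U H(1)] by blast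
  moreover have "F \<subseteq> D"
  proof (rule subrelI)
    fix x y assume xy: "(x, y) \<in> F"
    then have "(\<phi> \<one> x, \<phi> \<one> y) \<in> D" by (auto simp: F_def)
    moreover have "\<phi> \<one> x = x" "\<phi> \<one> y = y"
      using xy by (auto simp: F_def simp flip: id_eq_one)
    ultimately show "(x, y) \<in> D" by simp
  qed
  moreover have "(\<phi> g x, \<phi> g y) \<in> F" if "(x, y) \<in> F" "g \<in> carrier G" for x y g
  proof -
    have xy: "x \<in> E" "y \<in> E" using that(1) by (auto simp: F_def)
    moreover have "\<phi> g x \<in> E" "\<phi> g y \<in> E" using xy that(2) element_image by blast+
    moreover have "(\<phi> h (\<phi> g x), \<phi> h (\<phi> g y)) \<in> D" if h: "h \<in> carrier G" for h
    proof -
      have "(\<phi> (h \<otimes> g) x, \<phi> (h \<otimes> g) y) \<in> D"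
        using \<open>(x, y) \<in> F\<close> h \<open>g \<in> carrier G\<close> by (auto simp: F_def)
      then show ?thesis
        using xy h \<open>g \<in> carrier G\<close> by (simp add: composition_rule)
    qed
    ultimately show ?thesis by (simp add: F_def)
  qed
  ultimately show ?thesis by (intro bexI[of _ F]) auto
qed

text \<open>A lift of a step at some point of the fibre is translated to the prescribed point.\<close>
lemma invariant_lifts_steps:
  assumes FE: "F \<subseteq> E \<times> E" and inv: "\<forall>(x, y)\<in>F. \<forall>g\<in>carrier G. (\<phi> g x, \<phi> g y) \<in> F"
  shows "lifts_steps E (orbit G \<phi>) F"
  unfolding lifts_steps_def
proof (intro ballI allI impI)
  fix x q
  assume x: "x \<in> E" and "(orbit G \<phi> x, q) \<in> rel_image (orbit G \<phi>) F"
  then obtain a b where ab: "(a, b) \<in> F" "orbit G \<phi> a = orbit G \<phi> x" "q = orbit G \<phi> b"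
    by (auto simp: rel_image_def)
  then obtain g where g: "g \<in> carrier G" "x = \<phi> g a"
    using orbit_eq_imp_translate[OF x] by blast
  have "(x, \<phi> g b) \<in> F" using inv ab(1) g by blast
  moreover have "orbit G \<phi> (\<phi> g b) = q" using orbit_translate[of b g] FE ab g by blast
  ultimately show "\<exists>y. (x, y) \<in> F \<and> orbit G \<phi> y = q" by blast
qed

text \<open>Both points being close to \<open>x\<close>, they are close to each other, and proper discontinuity forbids
  a nontrivial element of \<open>G\<close> to move a point so little.\<close>
lemma orbit_inj_on_neighbours:
  assumes U: "uniform_structure E U" and upd: "uniformly_properly_discontinuous G E U \<phi>"
  shows "\<exists>F\<in>U. \<forall>x y y'. (x, y) \<in> F \<and> (x, y') \<in> F \<and> orbit G \<phi> y = orbit G \<phi> y' \<longrightarrow> y = y'"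
proof -
  obtain D where D: "D \<in> U" "\<And>x g. x \<in> E \<Longrightarrow> g \<in> carrier G \<Longrightarrow> (x, \<phi> g x) \<in> D \<Longrightarrow> g = \<one>\<^bsub>G\<^esub>"
    using upd unfolding uniformly_properly_discontinuous_def by blast
  then obtain F where F: "F \<in> U" "F O F \<subseteq> D"
    using uniform_structureD(7)[OF U] by blast
  note FE = uniform_structureD(2,4)[OF U F(1)]
  have "y = y'" if xy: "(x, y) \<in> F" "(x, y') \<in> F" "orbit G \<phi> y = orbit G \<phi> y'" for x y y'
  proof -
    have E: "y \<in> E" "y' \<in> E" using xy FE(1) by blast+
    then obtain g where g: "g \<in> carrier G" "y' = \<phi> g y"
      using orbit_eq_imp_translate xy(3) by blast
    have "(y, y') \<in> D" using xy FE(2) F(2) by (blast dest: symD)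
    with D(2) E g have "g = \<one>\<^bsub>G\<^esub>" by blast
    then show ?thesis using g E id_eq_one by (metis restrict_apply')
  qed
  with F(1) show ?thesis by blast
qed

end

theorem corollary3p10:
  fixes G :: "('g, 'm) monoid_scheme"
    and X :: "'a set"
    and U :: "('a \<times> 'a) set set"
    and \<phi> :: "'g \<Rightarrow> 'a \<Rightarrow> 'a"
  assumes "uniform_structure X U"
    and "group_action G X \<phi>"
    and "discrete_action G X U \<phi>"
  defines "V \<equiv> generated_entourages U (orbits G X \<phi>) (orbit G \<phi>)"
  shows "uniform_structure (orbits G X \<phi>) V \<and>
         uniform_covering_map X U (orbits G X \<phi>) V (orbit G \<phi>)"
proof -
  interpret group_action G X \<phi> by fact
  have eq: "equicontinuous_action G U \<phi>" and upd: "uniformly_properly_discontinuous G X U \<phi>"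
    using assms(3) by (simp_all add: discrete_action_def)
  have base: "\<exists>F\<in>U. F \<subseteq> E \<and> lifts_steps X (orbit G \<phi>) F" if E: "E \<in> U" for E
  proof -
    obtain F where F: "F \<in> U" "F \<subseteq> E" "\<forall>(x, y)\<in>F. \<forall>g\<in>carrier G. (\<phi> g x, \<phi> g y) \<in> F"
      using invariant_entourage[OF assms(1) eq E] by blast
    moreover have "F \<subseteq> X \<times> X" using uniform_structureD(2)[OF assms(1) F(1)] .
    ultimately show ?thesis by (intro bexI[of _ F] conjI invariant_lifts_steps)
  qed
  obtain F where "F \<in> U"
    "\<And>x y y'. (x, y) \<in> F \<Longrightarrow> (x, y') \<in> F \<Longrightarrow> orbit G \<phi> y = orbit G \<phi> y' \<Longrightarrow> y = y'"
    using orbit_inj_on_neighbours[OF assms(1) upd] by blast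
  then have "unique_chain_lifts X U (orbit G \<phi>)" by (rule unique_chain_liftsI)
  moreover note uniform_structure_generated_entourages[OF assms(1) base]
    generates_generated_entourages[OF assms(1)] chain_liftingI[OF assms(1) base]
  ultimately show ?thesis
    unfolding V_def orbits_eq_image uniform_covering_map_def by blast
qed

end
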